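(* Let $s,t\ge1$ be coprime integers, and put $s'=\lfloor s/2\rfloor$, $t'=\lfloor t/2\rfloor$. (1) The set $\mathcal{D}_s\cap\mathcal{D}_t$ of self-conjugate simultaneous $s$- and $t$-cores is parameterized by each of the following sets: (a) via $a$-coordinates, the set $B_t(s)$ of points $(a_{t,i})_{i\in\mathbb{Z}/t\mathbb{Z}}\in A_t(s)$ satisfying $a_{t,i}+a_{t,-1-i}=t-1$ for all $i$; (b) via $z$-coordinates, the set $U_t(s)$ of points $(z_{t,i})_{i\in\mathbb{Z}/t\mathbb{Z}}\in\mathrm{TD}_t(s)$ satisfying $z_{t,i}=z_{t,-i}$ for all $i$; (c) via $u$-coordinates, the set $\{(u_0,u_1,\ldots,u_{t'})\in\mathbb{Z}_{\ge0}^{1+t'}:u_0+u_1+\cdots+u_{t'}=s'\}$. Here the change of variables from $a$- to $z$-coordinates restricts to a bijection $B_t(s)\to U_t(s)$, and the bijection from $U_t(s)$ to the set in (c) is given by $u_0=\lfloor z_{t,0}/2\rfloor=s'-\sum_{i=1}^{t'}u_i$ together with: $u_i=z_{t,i}$ for $1\le i\le t'$ if $t$ is odd; and $u_{t'}=z_{t,t'}/2$, $u_i=z_{t,i}$ for $1\le i\le t'-1$ if $t$ is even. (2) Under the same changes of coordinates, the set $\mathcal{D}_t$ of self-conjugate $t$-cores is parameterized by each of the following sets: (a) via $a$-coordinates, the set of integer points $(a_{t,i})_{i\in\mathbb{Z}/t\mathbb{Z}}$ with $\sum_ia_{t,i}=\binom t2$, $a_{t,i}\equiv i\pmod t$ and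 $a_{t,i}+a_{t,-1-i}=t-1$ for all $i$; (b) via $z$-coordinates, the set of integer points $(z_{t,i})_{i\in\mathbb{Z}/t\mathbb{Z}}$ with $\sum_iz_{t,i}=s$, $\sum_i i\,z_{t,i}\equiv0\pmod t$, and $z_{t,i}=z_{t,-i}$ for all $i$; (c) via $u$-coordinates (defined from the $z$-coordinates by the same formulas as in (1)), the set $\{(u_0,u_1,\ldots,u_{t'})\in\mathbb{Z}^{1+t'}:u_0+u_1+\cdots+u_{t'}=s'\}$.
   Context: A partition is an infinite weakly decreasing sequence $\lambda=(\lambda_1,\lambda_2,\ldots)$ of nonnegative integers with finite sum; its conjugate $\overline{\lambda}$ is given by $\overline{\lambda}_r=\#\{c\in\mathbb{Z}_{>0}: r\le\lambda_c\}$, and $\lambda$ is self-conjugate if $\lambda=\overline\lambda$. Its beta-set is $B^\lambda=\{\lambda_i-i: i\ge1\}\subset\mathbb{Z}$. A partition is a $t$-core if it has no hook of length $t$, equivalently if $B^\lambda-t\subseteq B^\lambda$; $\mathcal{C}_t$ (resp. $\mathcal{D}_t$) is the set of $t$-cores (resp. self-conjugate $t$-cores). $a$-coordinates: for a $t$-core $\lambda$ and $i\in\mathbb{Z}$ (only $i$ mod $t$ matters), $a_{t,i}(\lambda)=t+\max[B^\lambda\cap(i+t\mathbb{Z})]$. $z$-coordinates: with $k=\frac12(s+1)(t-1)\in\mathbb{Z}$, the change of variables from $a$- to $z$-coordinates is $z_{t,j}=\frac1t\bigl(a_{t,sj+k}-[a_{t,s(j+1)+k}-s]\bigr)$ for $j\in\mathbb{Z}/t\mathbb{Z}$.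 $A_t(s)$ is the set of integer points $(a_{t,i})_{i\in\mathbb{Z}/t\mathbb{Z}}$ with $a_{t,i}\ge a_{t,i+s}-s$ and $a_{t,i}\equiv i\pmod t$ for all $i$, and $\sum_ia_{t,i}=\binom t2$. $\mathrm{TD}_t(s)$ is the set of points $(z_{t,i})_{i\in\mathbb{Z}/t\mathbb{Z}}\in\mathbb{Z}_{\ge0}^t$ with $\sum_iz_{t,i}=s$ and $\sum_i i\,z_{t,i}\equiv0\pmod t$. "Parameterized" means that the map sending a partition to its indicated coordinates is a bijection onto the indicated set. All indices of $a_{t,\cdot}$ and $z_{t,\cdot}$ are taken modulo $t$. *)

theory Defs
  imports Complex_Main "HOL-Library.FuncSet" "HOL-Number_Theory.Cong"
begin

text \<open>
  A partition is a function on \<open>nat\<close> shifted by one: \<open>l i\<close> is the part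
  \<open>\<lambda>\<^sub>i\<^sub>+\<^sub>1\<close>. A sequence of natural numbers has finite sum iff it has
  only finitely many nonzero terms.
\<close>

definition is_partition :: "(nat \<Rightarrow> nat) \<Rightarrow> bool" where
  "is_partition l \<longleftrightarrow> antimono l \<and> finite {i. l i \<noteq> 0}"

text \<open>With the shift, the condition \<open>r + 1 \<le> \<lambda>\<^sub>c\<^sub>+\<^sub>1\<close> reads \<open>r < l c\<close>.\<close>

definition conjugate :: "(nat \<Rightarrow> nat) \<Rightarrow> nat \<Rightarrow> nat" where
  "conjugate l r = card {c. r < l c}"

definition beta_set :: "(nat \<Rightarrow> nat) \<Rightarrow> int set" where
  "beta_set l = {int (l i) - int (Suc i) | i. True}"

text \<open>
  Arm plus leg plus one for the cell in row \<open>i\<close> and column \<open>j\<close> (both counted from 0).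
  For cells of the diagram, that is \<open>j < l i\<close>, no subtraction truncates.
\<close>

definition hook_length :: "(nat \<Rightarrow> nat) \<Rightarrow> nat \<Rightarrow> nat \<Rightarrow> nat" where
  "hook_length l i j = (l i - Suc j) + (conjugate l j - Suc i) + 1"

definition cores :: "nat \<Rightarrow> (nat \<Rightarrow> nat) set" where
  "cores t = {l. is_partition l \<and> (\<forall>i j. j < l i \<longrightarrow> hook_length l i j \<noteq> t)}"

definition self_conjugate_cores :: "nat \<Rightarrow> (nat \<Rightarrow> nat) set" where
  "self_conjugate_cores t = {l \<in> cores t. conjugate l = l}"

text \<open>
  Points indexed by \<open>\<int>/t\<int>\<close> are functions on \<open>int\<close> of period \<open>t\<close>;
  sums over \<open>\<int>/t\<int>\<close> run over the representatives \<open>0, \<dots>, t - 1\<close>.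
\<close>

definition periodic :: "nat \<Rightarrow> (int \<Rightarrow> int) \<Rightarrow> bool" where
  "periodic t f \<longleftrightarrow> (\<forall>i. f (i + int t) = f i)"

definition a_coord :: "nat \<Rightarrow> (nat \<Rightarrow> nat) \<Rightarrow> int \<Rightarrow> int" where
  "a_coord t l i = int t + (GREATEST x. x \<in> beta_set l \<and> [x = i] (mod int t))"

definition z_shift :: "nat \<Rightarrow> nat \<Rightarrow> int" where
  "z_shift s t = (int s + 1) * (int t - 1) div 2"

lemma two_times_z_shift:
  assumes "coprime s t"
  shows "2 * z_shift s t = (int s + 1) * (int t - 1)"
proof -
  have "odd s \<or> odd t"
    using assms by (metis coprime_common_divisor_nat dvd_refl numeral_One numeral_eq_iff semiring_norm(85))
  then show ?thesis
    unfolding z_shift_def by (intro dvd_mult_div_cancel) auto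
qed

text \<open>
  The numerator of the change of variables from \<open>a\<close>- to \<open>z\<close>-coordinates is a multiple
  of \<open>t\<close> whenever \<open>a i\<close> is congruent to \<open>i\<close> modulo \<open>t\<close> for all \<open>i\<close>, so that the
  integer division below is exact.
\<close>

definition z_numerator :: "nat \<Rightarrow> nat \<Rightarrow> (int \<Rightarrow> int) \<Rightarrow> int \<Rightarrow> int" where
  "z_numerator s t a j =
     a (int s * j + z_shift s t) - (a (int s * (j + 1) + z_shift s t) - int s)"

definition z_of_a :: "nat \<Rightarrow> nat \<Rightarrow> (int \<Rightarrow> int) \<Rightarrow> int \<Rightarrow> int" where
  "z_of_a s t a j = z_numerator s t a j div int t"

definition z_coord :: "nat \<Rightarrow> nat \<Rightarrow> (nat \<Rightarrow> nat) \<Rightarrow> int \<Rightarrow> int" where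
  "z_coord s t l = z_of_a s t (a_coord t l)"

text \<open>
  The point \<open>(u\<^sub>0, \<dots>, u\<^sub>m)\<close>, \<open>m = t div 2\<close>, is an extensional function on \<open>{..m}\<close>.
  The first \<open>div\<close> is the floor, also for negative \<open>z 0\<close>; the second one is exact on
  the points of interest, where \<open>z m\<close> is even if \<open>t\<close> is even.
\<close>

definition u_of_z :: "nat \<Rightarrow> (int \<Rightarrow> int) \<Rightarrow> nat \<Rightarrow> int" where
  "u_of_z t z = (\<lambda>i\<in>{..t div 2}.
     if i = 0 then z 0 div 2
     else if even t \<and> i = t div 2 then z (int i) div 2
     else z (int i))"

definition u_coord :: "nat \<Rightarrow> nat \<Rightarrow> (nat \<Rightarrow> nat) \<Rightarrow> nat \<Rightarrow> int" where
  "u_coord s t l = u_of_z t (z_coord s t l)"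

definition A_points :: "nat \<Rightarrow> nat \<Rightarrow> (int \<Rightarrow> int) set" where
  "A_points t s = {a. periodic t a \<and>
     (\<forall>i. a i \<ge> a (i + int s) - int s) \<and>
     (\<forall>i. [a i = i] (mod int t)) \<and>
     (\<Sum>i\<in>{0..<int t}. a i) = int (t choose 2)}"

definition TD_points :: "nat \<Rightarrow> nat \<Rightarrow> (int \<Rightarrow> int) set" where
  "TD_points t s = {z. periodic t z \<and>
     (\<forall>i. z i \<ge> 0) \<and>
     (\<Sum>i\<in>{0..<int t}. z i) = int s \<and>
     [(\<Sum>i\<in>{0..<int t}. i * z i) = 0] (mod int t)}"

definition B_points :: "nat \<Rightarrow> nat \<Rightarrow> (int \<Rightarrow> int) set" where
  "B_points t s = {a \<in> A_points t s. \<forall>i. a i + a (- 1 - i) = int t - 1}"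

definition U_points :: "nat \<Rightarrow> nat \<Rightarrow> (int \<Rightarrow> int) set" where
  "U_points t s = {z \<in> TD_points t s. \<forall>i. z i = z (- i)}"

end

theory Submission
  imports Defs "HOL-Library.Infinite_Set"
begin

text \<open>
  Write \<open>B\<close> for the beta-set of \<open>\<lambda>\<close>. Conjugation replaces \<open>B\<close> by the set of all
  \<open>- 1 - x\<close> with \<open>x \<notin> B\<close>, and hook lengths are the positive differences \<open>x - y\<close> with
  \<open>x \<in> B\<close> and \<open>y \<notin> B\<close>. A \<open>t\<close>-core is therefore the same as its \<open>a\<close>-coordinates via
  \<open>x \<in> B \<longleftrightarrow> x + t \<le> a x\<close>; self-conjugacy reads \<open>a i + a (- 1 - i) = t - 1\<close>, and being an
  \<open>s\<close>-core as well reads \<open>a i \<ge> a (i + s) - s\<close>.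

  Listing the residues as \<open>s j + k\<close>, the \<open>z\<close>-coordinates are the successive differences of
  \<open>A j = a (s j + k)\<close>, and since \<open>2 k + 1 + s = (s + 1) t\<close> the symmetry becomes
  \<open>A j + A (1 - j) = t - 1\<close>, that is \<open>z j = z (- j)\<close> together with the value of \<open>A 0\<close>.
  For symmetric \<open>z\<close> the weighted congruence says only that \<open>z (t / 2)\<close> is even when \<open>t\<close> is
  even, so a symmetric \<open>z\<close> amounts to the free choice of one half of its entries.
\<close>

text \<open>The full sets of part (2); those of part (1) are obtained from them by adding
  inequalities.\<close>

definition symmetric_a_points :: "nat \<Rightarrow> (int \<Rightarrow> int) set" where
  "symmetric_a_points t = {a. periodic t a \<and>
     (\<Sum>i\<in>{0..<int t}. a i) = int (t choose 2) \<and>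
     (\<forall>i. [a i = i] (mod int t)) \<and>
     (\<forall>i. a i + a (- 1 - i) = int t - 1)}"

definition symmetric_z_points :: "nat \<Rightarrow> nat \<Rightarrow> (int \<Rightarrow> int) set" where
  "symmetric_z_points s t = {z. periodic t z \<and>
     (\<Sum>i\<in>{0..<int t}. z i) = int s \<and>
     [(\<Sum>i\<in>{0..<int t}. i * z i) = 0] (mod int t) \<and>
     (\<forall>i. z i = z (- i))}"

section \<open>Beta-sets and a-coordinates\<close>

text \<open>The rows that reach column \<open>r\<close> form a finite initial segment of
  \<open>nat\<close>, so their number is the first row that does not. Both sides thus say that the
  cell in row \<open>c\<close> and column \<open>r\<close> lies in the diagram.\<close>

lemma less_conjugate_iff:
  assumes "is_partition l"
  shows "c < conjugate l r \<longleftrightarrow> r < l c"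
proof -
  have anti: "l d \<le> l c" if "c \<le> d" for c d
    using assms that by (auto simp: is_partition_def antimono_def)
  have fin: "finite {c. r < l c}"
    using assms by (auto simp: is_partition_def elim: rev_finite_subset)
  have down: "d \<in> {c. r < l c}" if "c \<in> {c. r < l c}" "d \<le> c" for c d
    using that anti[of d c] by auto
  define n where "n = (LEAST c. \<not> r < l c)"
  have "\<exists>c. \<not> r < l c"
    using fin infinite_UNIV_nat by (metis (mono_tags) Collect_cong UNIV_def)
  then have n: "\<not> r < l n" unfolding n_def by (rule LeastI_ex)
  have "{c. r < l c} = {..<n}"
  proof (intro set_eqI iffI)
    fix c assume "c \<in> {c. r < l c}"
    then show "c \<in> {..<n}" using n down by (metis lessThan_iff linorder_not_less mem_Collect_eq)
  next
    fix c assume "c \<in> {..<n}"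
    then show "c \<in> {c. r < l c}" unfolding n_def using not_less_Least by auto
  qed
  then have "conjugate l r = n" "\<And>c. r < l c \<longleftrightarrow> c < n"
    by (auto simp: conjugate_def)
  then show ?thesis by simp
qed

lemma beta_setI: "int (l i) - int (Suc i) \<in> beta_set l"
  unfolding beta_set_def by blast

lemma beta_setE:
  assumes "x \<in> beta_set l"
  obtains i where "x = int (l i) - int (Suc i)"
  using assms unfolding beta_set_def by blast

lemma beta_set_conjugate:
  assumes "is_partition l"
  shows "x \<in> beta_set (conjugate l) \<longleftrightarrow> - 1 - x \<notin> beta_set l"
proof
  assume "x \<in> beta_set (conjugate l)"
  then obtain r where r: "x = int (conjugate l r) - int (Suc r)"
    by (rule beta_setE)
  show "- 1 - x \<notin> beta_set l"
  proof
    assume "- 1 - x \<in> beta_set l"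
    then obtain i where "- 1 - x = int (l i) - int (Suc i)" by (rule beta_setE)
    \<comment> \<open>The two equations add up to \<open>l i + conjugate l r = i + r + 1\<close>,
      but this sum is at least \<open>i + r + 2\<close> for a cell of the diagram and at most
      \<open>i + r\<close> for any other.\<close>
    with r less_conjugate_iff[OF assms, of i r] show False by linarith
  qed
next
  assume *: "- 1 - x \<notin> beta_set l"
  define y where "y = - 1 - x"
  have l0: "l i \<le> l 0" for i using assms by (auto simp: is_partition_def antimono_def)
  \<comment> \<open>Row \<open>i\<close> is the first whose beta-number does not exceed the gap
    \<open>y\<close>. Column \<open>y + i\<close> then meets exactly the rows before
    \<open>i\<close>, so its length is \<open>i\<close>.\<close>
  define i where "i = (LEAST i. int (l i) - int (Suc i) \<le> y)"
  have "int (l (nat (int (l 0) - y))) - int (Suc (nat (int (l 0) - y))) \<le> y"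
    using l0[of "nat (int (l 0) - y)"] by linarith
  then have i: "int (l i) - int (Suc i) \<le> y" unfolding i_def by (rule LeastI)
  moreover have "int (l i) - int (Suc i) \<noteq> y" using * beta_setI[of l i] by (auto simp: y_def simp del: of_nat_Suc)
  ultimately have ri: "int (l i) \<le> y + int i" by linarith
  define r where "r = nat (y + int i)"
  have r: "int r = y + int i" using ri unfolding r_def by linarith
  have "\<not> r < l i" using ri r by linarith
  moreover have "r < l j" if "j < i" for j
  proof -
    have "r < l (i - 1)"
      using not_less_Least[of "i - 1" "\<lambda>i. int (l i) - int (Suc i) \<le> y"] that r
      unfolding i_def[symmetric] by auto
    moreover have "l (i - 1) \<le> l j"
      using assms that by (auto simp: is_partition_def antimono_def)
    ultimately show ?thesis by simp
  qed
  ultimately have "conjugate l r = i"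
    using less_conjugate_iff[OF assms] by (metis linorder_neqE_nat less_irrefl)
  then have "x = int (conjugate l r) - int (Suc r)" using r by (simp add: y_def)
  then show "x \<in> beta_set (conjugate l)" using beta_setI by metis
qed

text \<open>The hook at row \<open>i\<close> and column \<open>j\<close> has length
  \<open>x - y\<close>, where \<open>x\<close> is the beta-number of row \<open>i\<close> and
  \<open>y = j - conjugate l j\<close> is the gap belonging to column \<open>j\<close>.\<close>

lemma cores_iff:
  assumes "is_partition l" "t \<ge> 1"
  shows "l \<in> cores t \<longleftrightarrow> (\<forall>x\<in>beta_set l. x - int t \<in> beta_set l)"
proof
  assume core: "l \<in> cores t"
  show "\<forall>x\<in>beta_set l. x - int t \<in> beta_set l"
  proof (rule ballI, rule ccontr)
    fix x assume x: "x \<in> beta_set l" and "x - int t \<notin> beta_set l"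
    then have "- 1 - (x - int t) \<in> beta_set (conjugate l)"
      using beta_set_conjugate[OF assms(1)] by simp
    then obtain j where j: "- 1 - (x - int t) = int (conjugate l j) - int (Suc j)"
      by (rule beta_setE)
    obtain i where i: "x = int (l i) - int (Suc i)" using x by (rule beta_setE)
    \<comment> \<open>The equations give \<open>l i + conjugate l j = i + j + 1 + t\<close>, whereas
      outside the diagram the left-hand side is at most \<open>i + j\<close>.\<close>
    have ij: "j < l i"
      using i j assms(2) less_conjugate_iff[OF assms(1), of i j] by linarith
    then have "hook_length l i j = t"
      using i j less_conjugate_iff[OF assms(1), of i j] unfolding hook_length_def by linarith
    with core ij show False by (auto simp: cores_def)
  qed
next
  assume *: "\<forall>x\<in>beta_set l. x - int t \<in> beta_set l"
  have "hook_length l i j \<noteq> t" if ij: "j < l i" for i j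
  proof
    assume "hook_length l i j = t"
    then have "int (l i) - int (Suc i) - int t = - 1 - (int (conjugate l j) - int (Suc j))"
      using ij less_conjugate_iff[OF assms(1), of i j] unfolding hook_length_def by linarith
    moreover have "int (l i) - int (Suc i) \<in> beta_set l"
      "int (conjugate l j) - int (Suc j) \<in> beta_set (conjugate l)"
      by (rule beta_setI)+
    ultimately show False using * beta_set_conjugate[OF assms(1)] by metis
  qed
  then show "l \<in> cores t" using assms(1) by (simp add: cores_def)
qed

text \<open>Beta-numbers strictly decrease along the rows, so row \<open>n\<close> carries the
  element of rank \<open>n\<close> from the top, and strong induction recovers the parts.\<close>

lemma beta_set_inj:
  assumes "antimono l" "antimono m" "beta_set l = beta_set m"
  shows "l = m"
proof
  \<comment> \<open>Stated for one inclusion, so that exchanging \<open>l\<close> and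
    \<open>m\<close> gives the reverse inequality.\<close>
  have le: "l n \<le> m n"
    if anti: "antimono l" "antimono m" and sub: "beta_set l \<subseteq> beta_set m"
      and IH: "\<And>k. k < n \<Longrightarrow> l k = m k" for l m n
  proof -
    have "int (l n) - int (Suc n) \<in> beta_set m" using sub beta_setI by blast
    then obtain k where k: "int (l n) - int (Suc n) = int (m k) - int (Suc k)"
      by (rule beta_setE)
    have "k \<ge> n"
    proof (rule ccontr)
      assume "\<not> k \<ge> n"
      then have "l n \<le> l k" "l k = m k" using antimonoD[OF anti(1), of k n] IH[of k] by simp_all
      with k \<open>\<not> k \<ge> n\<close> show False by linarith
    qed
    then have "m k \<le> m n" using anti by (auto simp: antimono_def)
    with k \<open>k \<ge> n\<close> show ?thesis by linarith
  qed
  fix n show "l n = m n"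
  proof (induction n rule: less_induct)
    case (less n)
    show ?case
      using le[of l m n] le[of m l n] assms less by force
  qed
qed

lemma self_conjugate_beta_set:
  assumes "is_partition l"
  shows "conjugate l = l \<longleftrightarrow> (\<forall>x. x \<in> beta_set l \<longleftrightarrow> - 1 - x \<notin> beta_set l)"
proof
  assume "conjugate l = l"
  then show "\<forall>x. x \<in> beta_set l \<longleftrightarrow> - 1 - x \<notin> beta_set l"
    using beta_set_conjugate[OF assms] by metis
next
  assume "\<forall>x. x \<in> beta_set l \<longleftrightarrow> - 1 - x \<notin> beta_set l"
  then have "beta_set (conjugate l) = beta_set l"
    using beta_set_conjugate[OF assms] by blast
  moreover have "antimono (conjugate l)"
  proof (rule antimonoI, rule ccontr)
    fix r q :: nat assume "r \<le> q" "\<not> conjugate l q \<le> conjugate l r"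
    then show False
      using less_conjugate_iff[OF assms, of "conjugate l r" r]
        less_conjugate_iff[OF assms, of "conjugate l r" q] by simp
  qed
  ultimately show "conjugate l = l"
    using beta_set_inj assms by (auto simp: is_partition_def)
qed

section \<open>Partitions with a prescribed symmetric beta-set\<close>

text \<open>
  The difference of the two sides is unchanged when \<open>x\<close> becomes \<open>x + 1\<close>, and it vanishes
  at \<open>x = 0\<close> because of the symmetry \<open>y \<mapsto> - 1 - y\<close>.
\<close>

lemma card_gaps_symmetric:
  fixes B :: "int set"
  assumes sym: "\<And>x. x \<in> B \<longleftrightarrow> - 1 - x \<notin> B" and bound: "\<And>x. x \<in> B \<Longrightarrow> x \<le> M"
  shows "int (card {y. y \<notin> B \<and> y < x}) = x + int (card {y. y \<in> B \<and> x \<le> y})"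
proof -
  have fP: "finite {y. y \<in> B \<and> x \<le> y}" for x
    by (rule finite_subset[of _ "{x..M}"]) (auto dest: bound)
  \<comment> \<open>A gap \<open>y\<close> has \<open>- 1 - y\<close> in \<open>B\<close>, hence
    \<open>y \<ge> - 1 - M\<close>.\<close>
  have fN: "finite {y. y \<notin> B \<and> y < x}" for x
  proof (rule finite_subset[of _ "{- 1 - M..x}"])
    show "{y. y \<notin> B \<and> y < x} \<subseteq> {- 1 - M..x}"
      using sym bound by (smt (verit) atLeastAtMost_iff mem_Collect_eq subsetI)
  qed simp
  define D where "D x = int (card {y. y \<notin> B \<and> y < x}) - int (card {y. y \<in> B \<and> x \<le> y}) - x" for x
  have step: "D (x + 1) = D x" for x
  proof (cases "x \<in> B")
    case True
    have "{y. y \<notin> B \<and> y < x + 1} = {y. y \<notin> B \<and> y < x}"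
      using True by (smt (verit) Collect_cong)
    moreover have "{y. y \<in> B \<and> x \<le> y} = insert x {y. y \<in> B \<and> x + 1 \<le> y}"
      using True by (auto simp: order.order_iff_strict)
    ultimately show ?thesis using fP[of "x + 1"] by (simp add: D_def)
  next
    case False
    have "{y. y \<in> B \<and> x + 1 \<le> y} = {y. y \<in> B \<and> x \<le> y}"
      using False by (smt (verit) Collect_cong)
    moreover have "{y. y \<notin> B \<and> y < x + 1} = insert x {y. y \<notin> B \<and> y < x}"
      using False by (auto simp: zless_add1_eq)
    ultimately show ?thesis using fN[of x] by (simp add: D_def)
  qed
  have "D x = D 0"
  proof (induction x rule: int_induct[where k = 0])
    case (step2 i) then show ?case using step[of "i - 1"] by simp
  qed (use step in auto)
  moreover have "bij_betw (\<lambda>y. - 1 - y) {y. y \<notin> B \<and> y < 0} {y. y \<in> B \<and> 0 \<le> y}"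
  proof (rule bij_betw_byWitness[where f' = "\<lambda>y. - 1 - y"])
    show "(\<lambda>y. - 1 - y) ` {y. y \<notin> B \<and> y < 0} \<subseteq> {y. y \<in> B \<and> 0 \<le> y}"
      using sym by (smt (verit) image_subsetI mem_Collect_eq)
    show "(\<lambda>y. - 1 - y) ` {y. y \<in> B \<and> 0 \<le> y} \<subseteq> {y. y \<notin> B \<and> y < 0}"
      using sym by (smt (verit) image_subsetI mem_Collect_eq)
  qed auto
  then have "D 0 = 0" using bij_betw_same_card by (fastforce simp: D_def)
  ultimately show ?thesis unfolding D_def by simp
qed

text \<open>List \<open>B\<close> decreasingly as \<open>b 0, b 1, ...\<close> and let part
  \<open>i\<close> be the number of gaps below \<open>b i\<close>. By the preceding count this
  number is \<open>b i + i + 1\<close>, as a beta-number requires.\<close>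

lemma ex_partition_beta_set:
  fixes B :: "int set"
  assumes sym: "\<And>x. x \<in> B \<longleftrightarrow> - 1 - x \<notin> B" and bound: "\<And>x. x \<in> B \<Longrightarrow> x \<le> M"
  shows "\<exists>l. is_partition l \<and> beta_set l = B"
proof -
  \<comment> \<open>Measuring downwards from the bound \<open>M\<close> turns the increasing
    enumeration of an infinite set of naturals into a decreasing one of \<open>B\<close>.\<close>
  define S where "S = {n. M - int n \<in> B}"
  have "infinite S"
  proof
    assume "finite S"
    \<comment> \<open>If \<open>M - n\<close> is a gap, its mirror image \<open>n - 1 - M\<close>
      lies in \<open>B\<close> and is at most \<open>M\<close>, so
      \<open>n \<le> 2 * M + 1\<close>.\<close>
    moreover have "n \<in> S" if "n \<ge> nat (2 * M + 2)" for n
    proof (rule ccontr)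
      assume "n \<notin> S"
      then have "- 1 - (M - int n) \<in> B" using sym[of "M - int n"] unfolding S_def by blast
      then show False using bound that by force
    qed
    ultimately show False
      by (metis finite_nat_set_iff_bounded linorder_not_less max.cobounded1 max.cobounded2)
  qed
  define b where "b i = M - int (enumerate S i)" for i
  have b_less: "b j < b i" if "i < j" for i j
    using enumerate_mono[OF that \<open>infinite S\<close>] by (simp add: b_def)
  have range_b: "range b = B"
  proof (intro set_eqI iffI)
    fix x assume "x \<in> range b"
    then show "x \<in> B" using enumerate_in_set[OF \<open>infinite S\<close>] by (auto simp: b_def S_def)
  next
    fix x assume "x \<in> B"
    then have "nat (M - x) \<in> S" using bound unfolding S_def by simp
    then obtain i where "enumerate S i = nat (M - x)"
      using range_enumerate[OF \<open>infinite S\<close>] by (metis imageE)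
    then have "x = b i" using bound[OF \<open>x \<in> B\<close>] by (simp add: b_def)
    then show "x \<in> range b" by simp
  qed
  have fin: "finite {y. y \<notin> B \<and> y < x}" for x
  proof (rule finite_subset[of _ "{- 1 - M..x}"])
    show "{y. y \<notin> B \<and> y < x} \<subseteq> {- 1 - M..x}"
      using sym bound by (smt (verit) atLeastAtMost_iff mem_Collect_eq subsetI)
  qed simp
  define l where "l i = card {y. y \<notin> B \<and> y < b i}" for i
  have l: "int (l i) - int (Suc i) = b i" for i
  proof -
    have "{y. y \<in> B \<and> b i \<le> y} = b ` {..i}"
    proof (intro set_eqI iffI)
      fix y assume "y \<in> {y. y \<in> B \<and> b i \<le> y}"
      then obtain j where "y = b j" "b i \<le> b j" using range_b by auto
      then show "y \<in> b ` {..i}" using b_less[of i j] by (metis atMost_iff imageI linorder_not_less)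
    next
      fix y assume "y \<in> b ` {..i}"
      then obtain j where "y = b j" "j \<le> i" by auto
      then show "y \<in> {y. y \<in> B \<and> b i \<le> y}"
        using range_b b_less[of j i] by (cases "j = i") auto
    qed
    moreover have "inj_on b {..i}"
      by (rule inj_onI) (metis b_less less_irrefl linorder_neqE_nat)
    ultimately have "card {y. y \<in> B \<and> b i \<le> y} = Suc i" by (simp add: card_image)
    then show ?thesis
      using card_gaps_symmetric[OF sym bound, of "b i"] by (simp add: l_def)
  qed
  have "antimono l"
  proof (rule antimonoI)
    fix i j :: nat assume "i \<le> j"
    then have "b j \<le> b i" using b_less[of i j] by (cases "i = j") auto
    then show "l j \<le> l i" unfolding l_def by (intro card_mono fin) auto
  qed
  moreover have "finite {i. l i \<noteq> 0}"
  \<comment> \<open>From row \<open>2 * M + 2\<close> on,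
    \<open>b i \<le> M - i \<le> - M - 2\<close>, while every gap is at least
    \<open>- 1 - M\<close>; such rows are empty.\<close>
  proof (rule finite_subset[of _ "{..<nat (2 * M + 2)}"])
    show "{i. l i \<noteq> 0} \<subseteq> {..<nat (2 * M + 2)}"
    proof (rule subsetI, rule ccontr)
      fix i assume "i \<in> {i. l i \<noteq> 0}" and i: "i \<notin> {..<nat (2 * M + 2)}"
      then obtain y where y: "y \<notin> B" "y < b i"
        unfolding l_def by (metis (mono_tags, lifting) card_eq_0_iff ex_in_conv mem_Collect_eq)
      have "i \<le> enumerate S i" by (rule le_enumerate[OF \<open>infinite S\<close>])
      moreover have "- 1 - y \<le> M" using y sym[of y] bound by blast
      ultimately show False using i y by (simp add: b_def)
    qed
  qed simp
  ultimately have "is_partition l" by (simp add: is_partition_def)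
  moreover have "beta_set l = B"
    unfolding beta_set_def l using range_b by auto
  ultimately show ?thesis by blast
qed

section \<open>Functions on residue classes and the a-coordinates of cores\<close>

lemma periodic_cong:
  assumes "periodic t f" "[i = j] (mod int t)"
  shows "f i = f j"
proof -
  have shift: "f (i + int n * int t) = f i" for i n
  proof (induction n)
    case (Suc n)
    have "f (i + int (Suc n) * int t) = f (i + int n * int t + int t)"
      by (simp add: algebra_simps)
    then show ?case using Suc assms(1) by (simp add: periodic_def)
  qed simp
  obtain d where d: "j = i + int t * d"
    using assms(2) by (metis cong_iff_lin)
  show ?thesis
  proof (cases "d \<ge> 0")
    case True
    then show ?thesis using shift[of i "nat d"] d by (simp add: mult.commute)
  next
    case False
    then show ?thesis using shift[of j "nat (- d)"] d by (simp add: mult.commute)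
  qed
qed

text \<open>In each class modulo \<open>t\<close> the beta-set of a core is closed under subtracting
  \<open>t\<close>, bounded above by the first part, and nonempty because it contains all small
  integers. It is a downward ray with top \<open>a_coord t l x - t\<close>, so the
  \<open>GREATEST\<close> in the definition is attained.\<close>

lemma mem_beta_set_iff:
  assumes "l \<in> cores t" "t \<ge> 1"
  shows "x \<in> beta_set l \<longleftrightarrow> x + int t \<le> a_coord t l x"
    and "[a_coord t l x = x] (mod int t)"
proof -
  have part: "is_partition l" using assms by (simp add: cores_def)
  define B where "B = beta_set l"
  have closed: "y - int n * int t \<in> B" if "y \<in> B" for y n
  proof (induction n)
    case (Suc n)
    then have "y - int n * int t - int t \<in> B"
      using assms cores_iff[OF part] unfolding B_def by blast
    then show ?case by (simp add: algebra_simps)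
  qed (use that in simp)
  have bound: "y < int (l 0)" if "y \<in> B" for y
  proof -
    obtain i where "y = int (l i) - int (Suc i)" using \<open>y \<in> B\<close> unfolding B_def by (rule beta_setE)
    moreover have "l i \<le> l 0" using part by (auto simp: is_partition_def antimono_def)
    ultimately show ?thesis by simp
  qed
  have low: "\<exists>N. \<forall>y<N. y \<in> B"
  proof -
    have "finite {i. l i \<noteq> 0}" using part by (simp add: is_partition_def)
    then obtain m where m: "l i = 0" if "i \<ge> m" for i
      by (metis (mono_tags, lifting) finite_nat_set_iff_bounded linorder_not_less mem_Collect_eq)
    have "y \<in> B" if "y < - int m" for y
    proof -
      have "l (nat (- 1 - y)) = 0" using that m by simp
      then have "y = int (l (nat (- 1 - y))) - int (Suc (nat (- 1 - y)))" using that by simp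
      then show ?thesis unfolding B_def using beta_setI by metis
    qed
    then show ?thesis by blast
  qed
  then obtain N where N: "\<And>y. y < N \<Longrightarrow> y \<in> B" by blast
  \<comment> \<open>A finite window of the class, to which \<open>Max\<close> applies; elements
    below the window lie below its maximum anyway.\<close>
  define C where "C = {y \<in> B. [y = x] (mod int t) \<and> y \<ge> min x (N - 1 - int t)}"
  have finC: "finite C"
    by (rule finite_subset[of _ "{min x (N - 1 - int t)..int (l 0)}"])
      (auto simp: C_def dest: bound)
  \<comment> \<open>The largest integer below \<open>N\<close> in the class of \<open>x\<close>,
    which shows that the window is nonempty.\<close>
  define y0 where "y0 = N - 1 - (N - 1 - x) mod int t"
  have "y0 \<in> C"
  proof -
    have "0 \<le> (N - 1 - x) mod int t" "(N - 1 - x) mod int t < int t" using assms(2) by simp_all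
    moreover have "[y0 = x] (mod int t)"
    proof -
      have "y0 = x + int t * ((N - 1 - x) div int t)"
        unfolding y0_def by (simp add: minus_mult_div_eq_mod[symmetric])
      then show ?thesis by (simp add: cong_def)
    qed
    ultimately show ?thesis unfolding C_def using N by (auto simp: y0_def)
  qed
  then have "C \<noteq> {}" by blast
  define g where "g = Max C"
  have "g \<in> C" unfolding g_def using finC \<open>C \<noteq> {}\<close> by simp
  then have gB: "g \<in> B" and gx: "[g = x] (mod int t)" by (auto simp: C_def)
  have gmax: "y \<le> g" if "y \<in> B" "[y = x] (mod int t)" for y
  proof (cases "y \<ge> min x (N - 1 - int t)")
    case True
    then show ?thesis using that finC unfolding g_def C_def by (intro Max_ge) auto
  next
    case False
    then show ?thesis using \<open>g \<in> C\<close> by (auto simp: C_def)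
  qed
  have "(GREATEST y. y \<in> beta_set l \<and> [y = x] (mod int t)) = g"
    by (rule Greatest_equality) (use gB gx gmax in \<open>auto simp: B_def\<close>)
  then have a: "a_coord t l x = int t + g" by (simp add: a_coord_def)
  show "[a_coord t l x = x] (mod int t)" using gx a by (simp add: cong_def)
  have "x \<in> B \<longleftrightarrow> x \<le> g"
  proof
    assume "x \<in> B" then show "x \<le> g" using gmax by simp
  next
    assume "x \<le> g"
    obtain d where d: "g = x + int t * d" using gx by (metis cong_iff_lin cong_sym)
    have "d \<ge> 0" using \<open>x \<le> g\<close> d assms(2) by (simp add: zero_le_mult_iff)
    then show "x \<in> B" using closed[OF gB, of "nat d"] d by (simp add: mult.commute)
  qed
  then show "x \<in> beta_set l \<longleftrightarrow> x + int t \<le> a_coord t l x"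
    using a by (auto simp: B_def)
qed

lemma periodic_a_coord: "periodic t (a_coord t l)"
  by (simp add: periodic_def a_coord_def cong_def)

lemma sum_reflect:
  assumes "periodic t f"
  shows "(\<Sum>i\<in>{0..<int t}. f (- 1 - i)) = (\<Sum>i\<in>{0..<int t}. f i)"
proof (rule sum.reindex_bij_witness[where i = "\<lambda>i. int t - 1 - i" and j = "\<lambda>i. int t - 1 - i"])
  fix i assume "i \<in> {0..<int t}"
  show "f (int t - 1 - i) = f (- 1 - i)"
    by (rule periodic_cong[OF assms]) (simp add: cong_iff_dvd_diff)
qed auto

text \<open>Summing the symmetry relation over all residues counts each value twice and gives
  \<open>t * (t - 1)\<close>.\<close>

lemma symmetric_sum_eq:
  fixes a :: "int \<Rightarrow> int"
  assumes "periodic t a" "\<And>i. a i + a (- 1 - i) = int t - 1" "t \<ge> 1"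
  shows "(\<Sum>i\<in>{0..<int t}. a i) = int (t choose 2)"
proof -
  have "2 * (\<Sum>i\<in>{0..<int t}. a i) = (\<Sum>i\<in>{0..<int t}. a i + a (- 1 - i))"
    using sum_reflect[OF assms(1)] by (simp add: sum.distrib)
  also have "\<dots> = int t * (int t - 1)" using assms(2) by simp
  also have "\<dots> = int (2 * (t choose 2))"
  proof -
    have "2 * (t choose 2) = t * (t - 1)" unfolding choose_two by (cases t) auto
    then show ?thesis using assms(3) by (simp add: of_nat_diff)
  qed
  finally show ?thesis by simp
qed

lemma bij_betw_a_coord:
  assumes "t \<ge> 1"
  shows "bij_betw (a_coord t) (self_conjugate_cores t) (symmetric_a_points t)"
proof (rule bij_betw_imageI)
  show "inj_on (a_coord t) (self_conjugate_cores t)"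
  proof (rule inj_onI)
    fix l m assume "l \<in> self_conjugate_cores t" "m \<in> self_conjugate_cores t"
      and eq: "a_coord t l = a_coord t m"
    then have lm: "l \<in> cores t" "m \<in> cores t" by (auto simp: self_conjugate_cores_def)
    then have "beta_set l = beta_set m"
      using mem_beta_set_iff(1)[OF _ assms] eq by auto
    then show "l = m" using lm by (intro beta_set_inj) (auto simp: cores_def is_partition_def)
  qed
  have "a_coord t l \<in> symmetric_a_points t" if "l \<in> self_conjugate_cores t" for l
  proof -
    have l: "l \<in> cores t" "is_partition l" "conjugate l = l"
      using that by (auto simp: self_conjugate_cores_def cores_def)
    note mem = mem_beta_set_iff[OF l(1) assms]
    have sym: "x \<in> beta_set l \<longleftrightarrow> - 1 - x \<notin> beta_set l" for x
      using self_conjugate_beta_set[OF l(2)] l(3) by blast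
    have cong: "a_coord t l i = a_coord t l j" if "[i = j] (mod int t)" for i j
      using that periodic_a_coord periodic_cong by blast
    have add: "a_coord t l i + a_coord t l (- 1 - i) = int t - 1" for i
    proof -
      \<comment> \<open>\<open>x\<close> is the least element of its class outside the beta-set and
        \<open>x - t\<close> the greatest inside. Reflection exchanges inside and outside, so
        \<open>- 1 - x\<close> is the greatest element in the class of
        \<open>- 1 - i\<close>.\<close>
      define x where "x = a_coord t l i"
      have x: "[x = i] (mod int t)" using mem(2) by (simp add: x_def)
      then have ax: "a_coord t l x = x" "a_coord t l (x - int t) = x"
        using cong[of x i] cong[of "x - int t" i] by (auto simp: x_def cong_def)
      have "[- 1 - x = - 1 - i] (mod int t)" using x by (intro cong_diff cong_refl)
      then have ay: "a_coord t l (- 1 - x) = a_coord t l (- 1 - i)"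
        "a_coord t l (- 1 - (x - int t)) = a_coord t l (- 1 - i)"
        using cong[of "- 1 - x" "- 1 - i"] cong[of "- 1 - (x - int t)" "- 1 - x"]
        by (auto simp: cong_iff_dvd_diff)
      have "- 1 - x \<in> beta_set l" using sym[of x] mem(1)[of x] ax assms by simp
      moreover have "- 1 - (x - int t) \<notin> beta_set l"
        using sym[of "x - int t"] mem(1)[of "x - int t"] ax by simp
      ultimately have le: "int t - 1 - x \<le> a_coord t l (- 1 - i)"
        "a_coord t l (- 1 - i) < int t - 1 - x + int t"
        using mem(1)[of "- 1 - x"] mem(1)[of "- 1 - (x - int t)"] ay by auto
      have "[a_coord t l (- 1 - i) = - 1 - i] (mod int t)" by (rule mem(2))
      then have "[a_coord t l (- 1 - i) = - 1 - x] (mod int t)"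
        using \<open>[- 1 - x = - 1 - i] (mod int t)\<close> by (metis cong_sym cong_trans)
      then have "int t dvd a_coord t l (- 1 - i) - (int t - 1 - x)"
        by (auto simp: cong_iff_dvd_diff dvd_diff algebra_simps dest: dvd_diff[OF _ dvd_refl])
      then obtain d where d: "a_coord t l (- 1 - i) - (int t - 1 - x) = int t * d" ..
      then have "0 \<le> int t * d" "int t * d < int t" using le by linarith+
      then have "0 \<le> d" "d < 1"
        using assms by (simp_all add: zero_le_mult_iff)
      then have "d = 0" by simp
      then show ?thesis using d by (simp add: x_def)
    qed
    show ?thesis
      unfolding symmetric_a_points_def
      using add mem(2) periodic_a_coord[of t l] symmetric_sum_eq[of t "a_coord t l"] assms by auto
  qed
  moreover have "a \<in> a_coord t ` self_conjugate_cores t" if "a \<in> symmetric_a_points t" for a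
  proof -
    have per: "periodic t a" and ai: "\<And>i. [a i = i] (mod int t)"
      and add: "\<And>i. a i + a (- 1 - i) = int t - 1"
      using that by (auto simp: symmetric_a_points_def)
    \<comment> \<open>The only candidate, by the membership criterion for cores.\<close>
    define B where "B = {x. x + int t \<le> a x}"
    have sym: "x \<in> B \<longleftrightarrow> - 1 - x \<notin> B" for x
    proof -
      obtain d where d: "a x = x + int t * d" using ai by (metis cong_iff_lin cong_sym)
      \<comment> \<open>With \<open>a x = x + t * d\<close>, the left side is membership of
        \<open>x\<close> in \<open>B\<close>, and \<open>t * d \<le> 0\<close> is membership of
        \<open>- 1 - x\<close>.\<close>
      have "int t \<le> int t * d \<longleftrightarrow> \<not> int t * d \<le> 0"
      proof -
        have "int t * 1 \<le> int t * d \<longleftrightarrow> 1 \<le> d" "int t * d \<le> int t * 0 \<longleftrightarrow> d \<le> 0"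
          using assms by (subst mult_le_cancel_left_pos; simp)+
        then show ?thesis by auto
      qed
      then show ?thesis using add[of x] d unfolding B_def by auto
    qed
    define M where "M = Max (a ` {0..<int t})"
    have M: "a x \<le> M" for x
    proof -
      have "a x = a (x mod int t)" by (rule periodic_cong[OF per]) (simp add: cong_def)
      also have "\<dots> \<le> M" unfolding M_def using assms by (intro Max_ge) auto
      finally show ?thesis .
    qed
    have "x \<le> M" if "x \<in> B" for x using that M[of x] by (simp add: B_def)
    then obtain l where l: "is_partition l" "beta_set l = B"
      using ex_partition_beta_set[OF sym] by blast
    have core: "l \<in> cores t"
    proof -
      have "a (x - int t) = a x" for x
        by (rule periodic_cong[OF per]) (simp add: cong_iff_dvd_diff)
      then show ?thesis using cores_iff[OF l(1) assms] l(2) by (auto simp: B_def)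
    qed
    have "conjugate l = l" using self_conjugate_beta_set[OF l(1)] sym unfolding l(2) by blast
    with core have "l \<in> self_conjugate_cores t" by (simp add: self_conjugate_cores_def)
    moreover have "a_coord t l = a"
    proof
      fix i
      have ax: "a x = a i" if "[x = i] (mod int t)" for x
        using that periodic_cong[OF per] by blast
      have "(GREATEST x. x \<in> beta_set l \<and> [x = i] (mod int t)) = a i - int t"
      proof (rule Greatest_equality)
        have "[a i - int t = i] (mod int t)" using ai[of i] by (simp add: cong_def)
        then show "a i - int t \<in> beta_set l \<and> [a i - int t = i] (mod int t)"
          using ax[of "a i - int t"] l(2) by (simp add: B_def)
        show "y \<le> a i - int t" if "y \<in> beta_set l \<and> [y = i] (mod int t)" for y
          using ax[of y] that l(2) by (simp add: B_def)
      qed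
      then show "a_coord t l i = a i" by (simp add: a_coord_def)
    qed
    ultimately show ?thesis by blast
  qed
  ultimately show "a_coord t ` self_conjugate_cores t = symmetric_a_points t" by blast
qed

text \<open>Since the beta-set is a downward ray in every class modulo \<open>t\<close>, closure
  under subtracting \<open>s\<close> is decided at the top element
  \<open>a_coord t l (i + s) - t\<close> of each class.\<close>

lemma cores_a_coord_iff:
  assumes "l \<in> cores t" "t \<ge> 1" "s \<ge> 1"
  shows "l \<in> cores s \<longleftrightarrow> (\<forall>i. a_coord t l i \<ge> a_coord t l (i + int s) - int s)"
proof -
  have part: "is_partition l" using assms by (simp add: cores_def)
  note mem = mem_beta_set_iff[OF assms(1,2)]
  have "(\<forall>x\<in>beta_set l. x - int s \<in> beta_set l) \<longleftrightarrow>
    (\<forall>i. a_coord t l i \<ge> a_coord t l (i + int s) - int s)"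
  proof
    assume *: "\<forall>x\<in>beta_set l. x - int s \<in> beta_set l"
    show "\<forall>i. a_coord t l i \<ge> a_coord t l (i + int s) - int s"
    proof
      fix i
      define x where "x = a_coord t l (i + int s) - int t"
      have x: "[x = i + int s] (mod int t)"
        using mem(2)[of "i + int s"] by (simp add: x_def cong_def)
      then have "a_coord t l x = a_coord t l (i + int s)"
        using periodic_a_coord periodic_cong by blast
      then have "x \<in> beta_set l" using mem(1) by (simp add: x_def)
      then have "x - int s + int t \<le> a_coord t l (x - int s)" using * mem(1) by blast
      moreover have "[x - int s = i] (mod int t)"
        using x by (simp add: cong_iff_dvd_diff algebra_simps)
      then have "a_coord t l (x - int s) = a_coord t l i"
        using periodic_a_coord periodic_cong by blast
      ultimately show "a_coord t l i \<ge> a_coord t l (i + int s) - int s" by (simp add: x_def)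
    qed
  next
    assume *: "\<forall>i. a_coord t l i \<ge> a_coord t l (i + int s) - int s"
    show "\<forall>x\<in>beta_set l. x - int s \<in> beta_set l"
    proof
      fix x assume "x \<in> beta_set l"
      then show "x - int s \<in> beta_set l"
        using mem(1)[of x] mem(1)[of "x - int s"] *[rule_format, of "x - int s"] by simp
    qed
  qed
  then show ?thesis using cores_iff[OF part assms(3)] by simp
qed

section \<open>From z- to u-coordinates\<close>

text \<open>The residues above \<open>t div 2\<close> are folded back by
  \<open>n \<mapsto> t - n\<close>. There are \<open>t - 1 - t div 2\<close> of them: one fewer than
  \<open>t div 2\<close> for even \<open>t\<close>, where the middle residue is its own mirror
  image.\<close>

lemma sum_lessThan_fold:
  fixes f :: "nat \<Rightarrow> int"
  assumes "t \<ge> 1"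
  shows "(\<Sum>n<t. f n) = f 0 + (\<Sum>n\<in>{1..t div 2}. f n) + (\<Sum>n\<in>{1..t - 1 - t div 2}. f (t - n))"
proof -
  have "(\<Sum>n\<in>{1..t - 1 - t div 2}. f (t - n)) = sum f {t div 2 + 1..<t}"
    by (rule sum.reindex_bij_witness[where i = "\<lambda>n. t - n" and j = "\<lambda>n. t - n"]) auto
  moreover have "{..<t} = insert 0 ({1..t div 2} \<union> {t div 2 + 1..<t})"
    using assms by auto
  moreover have "sum f ({1..t div 2} \<union> {t div 2 + 1..<t}) = sum f {1..t div 2} + sum f {t div 2 + 1..<t}"
    by (rule sum.union_disjoint) auto
  ultimately show ?thesis by simp
qed

lemma sum_symmetric_fold:
  fixes z :: "int \<Rightarrow> int"
  assumes "t \<ge> 1" "periodic t z" "\<And>i. z i = z (- i)"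
  shows "(\<Sum>i\<in>{0..<int t}. z i) =
      z 0 + (\<Sum>n\<in>{1..t div 2}. z (int n)) + (\<Sum>n\<in>{1..t - 1 - t div 2}. z (int n))" (is ?thesis1)
    and "(\<Sum>i\<in>{0..<int t}. i * z i) =
      (\<Sum>n\<in>{1..t div 2}. int n * z (int n)) + (\<Sum>n\<in>{1..t - 1 - t div 2}. (int t - int n) * z (int n))"
      (is ?thesis2)
proof -
  have refl: "z (int (t - n)) = z (int n)" if "n \<in> {1..t - 1 - t div 2}" for n
  proof -
    have "z (int (t - n)) = z (- int n)"
    proof (rule periodic_cong[OF assms(2)])
      have "int (t - n) = - int n + int t * 1" using that by auto
      then show "[int (t - n) = - int n] (mod int t)" by (simp add: cong_def)
    qed
    then show ?thesis using assms(3) by metis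
  qed
  have nat: "(\<Sum>i\<in>{0..<int t}. g i) = (\<Sum>n<t. g (int n))" for g :: "int \<Rightarrow> int"
    using sum.atLeast_int_lessThan_int_shift[of g 0 t] by (simp add: atLeast0LessThan)
  show ?thesis1
    unfolding nat sum_lessThan_fold[OF assms(1)] using refl by simp
  have "(\<Sum>n\<in>{1..t - 1 - t div 2}. int (t - n) * z (int (t - n))) =
    (\<Sum>n\<in>{1..t - 1 - t div 2}. (int t - int n) * z (int n))"
    using refl by (intro sum.cong) (auto simp: of_nat_diff)
  then show ?thesis2
    unfolding nat sum_lessThan_fold[OF assms(1)] by simp
qed

lemma sum_half_split:
  fixes f :: "nat \<Rightarrow> int"
  assumes "t \<ge> 1"
  shows "(\<Sum>n\<in>{1..t div 2}. f n) =
    (\<Sum>n\<in>{1..t - 1 - t div 2}. f n) + (if even t then f (t div 2) else 0)"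
proof (cases "even t")
  case True
  then obtain m where "t = 2 * m" ..
  with assms have half: "t div 2 = Suc (m - 1)" "t - 1 - t div 2 = m - 1" by auto
  show ?thesis unfolding half(2) unfolding half(1) using True half(1) by simp
next
  case False
  then obtain m where "t = 2 * m + 1" by (rule oddE)
  then have "t - 1 - t div 2 = t div 2" by simp
  then show ?thesis using False by simp
qed

text \<open>A mirror pair contributes \<open>n * z n + (t - n) * z n = t * z n\<close>, which
  vanishes modulo \<open>t\<close>. Only the middle term \<open>(t / 2) * z (t / 2)\<close> for even
  \<open>t\<close> remains.\<close>

lemma weighted_sum_cong_iff:
  fixes z :: "int \<Rightarrow> int"
  assumes "t \<ge> 1" "periodic t z" "\<And>i. z i = z (- i)"
  shows "[(\<Sum>i\<in>{0..<int t}. i * z i) = 0] (mod int t) \<longleftrightarrow> (even t \<longrightarrow> even (z (int (t div 2))))"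
proof -
  have "(\<Sum>i\<in>{0..<int t}. i * z i) =
      int t * (\<Sum>n\<in>{1..t - 1 - t div 2}. z (int n)) +
      (if even t then int (t div 2) * z (int (t div 2)) else 0)"
    unfolding sum_symmetric_fold(2)[OF assms] sum_half_split[OF assms(1), of "\<lambda>n. int n * z (int n)"]
    by (simp add: left_diff_distrib sum_subtractf sum_distrib_left)
  then have "[(\<Sum>i\<in>{0..<int t}. i * z i) = 0] (mod int t) \<longleftrightarrow>
      (even t \<longrightarrow> int t dvd int (t div 2) * z (int (t div 2)))"
    by (auto simp: cong_0_iff dvd_add_right_iff)
  moreover have "int t dvd int (t div 2) * x \<longleftrightarrow> even x" if "even t" for x
  proof -
    from that obtain m where m: "t = 2 * m" ..
    then have "m \<noteq> 0" "int t = int m * 2" "t div 2 = m" using assms(1) by auto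
    then show ?thesis by simp
  qed
  ultimately show ?thesis by blast
qed

text \<open>Each mirror pair contributes twice its \<open>u\<close> entry, and so does the middle
  residue because \<open>u_of_z\<close> halves it.\<close>

lemma sum_eq_u_of_z:
  fixes z :: "int \<Rightarrow> int"
  assumes "t \<ge> 1" "periodic t z" "\<And>i. z i = z (- i)" "even t \<Longrightarrow> even (z (int (t div 2)))"
  shows "(\<Sum>i\<in>{0..<int t}. z i) = z 0 + 2 * (\<Sum>n\<in>{1..t div 2}. u_of_z t z n)"
proof -
  have "(\<Sum>n\<in>{1..t - 1 - t div 2}. u_of_z t z n) = (\<Sum>n\<in>{1..t - 1 - t div 2}. z (int n))"
  proof (rule sum.cong)
    fix n assume n: "n \<in> {1..t - 1 - t div 2}"
    have "\<not> (even t \<and> n = t div 2)"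
    proof
      assume "even t \<and> n = t div 2"
      then obtain m where "t = 2 * m" "n = m" by auto
      with n show False by auto
    qed
    moreover have "n \<le> t div 2" using n by auto
    ultimately show "u_of_z t z n = z (int n)" using n by (auto simp: u_of_z_def)
  qed simp
  moreover have "2 * u_of_z t z (t div 2) = z (int (t div 2))" if "even t"
    using that assms(1,4) by (auto simp: u_of_z_def)
  ultimately show ?thesis
    unfolding sum_symmetric_fold(1)[OF assms(1-3)] sum_half_split[OF assms(1)]
    by (simp add: algebra_simps)
qed

text \<open>Trades the two sum conditions for a parity condition and a formula for
  \<open>z 0\<close>, which exhibits the remaining entries up to \<open>t div 2\<close> as free
  parameters.\<close>

lemma symmetric_z_points_iff:
  assumes "t \<ge> 1"
  shows "z \<in> symmetric_z_points s t \<longleftrightarrow> periodic t z \<and> (\<forall>i. z i = z (- i)) \<and>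
    (even t \<longrightarrow> even (z (int (t div 2)))) \<and>
    z 0 = int s - 2 * (\<Sum>n\<in>{1..t div 2}. u_of_z t z n)"
proof (cases "periodic t z \<and> (\<forall>i. z i = z (- i))")
  case True
  then have per: "periodic t z" and sym: "\<And>i. z i = z (- i)" by blast+
  show ?thesis
    using weighted_sum_cong_iff[OF assms per sym] sum_eq_u_of_z[OF assms per sym] per sym
    unfolding symmetric_z_points_def mem_Collect_eq by (smt (verit))
next
  case False
  then show ?thesis by (auto simp: symmetric_z_points_def)
qed

text \<open>\<open>z 0\<close> and \<open>s\<close> differ by an even number, so taking the floor of
  half of each loses the same remainder.\<close>

lemma symmetric_z_points_zero:
  assumes "t \<ge> 1" "z \<in> symmetric_z_points s t"
  shows "z 0 div 2 = int (s div 2) - (\<Sum>n\<in>{1..t div 2}. u_of_z t z n)"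
    and "(\<Sum>n\<le>t div 2. u_of_z t z n) = int (s div 2)"
proof -
  have "z 0 = int s - 2 * (\<Sum>n\<in>{1..t div 2}. u_of_z t z n)"
    using assms(2) symmetric_z_points_iff[OF assms(1)] by blast
  then show *: "z 0 div 2 = int (s div 2) - (\<Sum>n\<in>{1..t div 2}. u_of_z t z n)"
    by (simp add: zdiv_int)
  have "{..t div 2} = insert 0 {1..t div 2}" by auto
  then have "(\<Sum>n\<le>t div 2. u_of_z t z n) = u_of_z t z 0 + (\<Sum>n\<in>{1..t div 2}. u_of_z t z n)"
    by simp
  then show "(\<Sum>n\<le>t div 2. u_of_z t z n) = int (s div 2)"
    using * by (simp add: u_of_z_def)
qed

text \<open>Every class modulo \<open>t\<close> contains \<open>n\<close> or \<open>- n\<close> for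
  some \<open>n \<le> t div 2\<close>.\<close>

lemma symmetric_periodic_eqI:
  fixes z w :: "int \<Rightarrow> int"
  assumes "t \<ge> 1" "periodic t z" "\<And>i. z i = z (- i)" "periodic t w" "\<And>i. w i = w (- i)"
    and eq: "\<And>n. n \<le> t div 2 \<Longrightarrow> z (int n) = w (int n)"
  shows "z = w"
proof
  fix i
  define r where "r = i mod int t"
  have r: "0 \<le> r" "r < int t" "[i = r] (mod int t)" "[i = r - int t] (mod int t)"
    using assms(1) by (simp_all add: r_def cong_def)
  have zr: "z i = z r" "z i = z (int t - r)" "w i = w r" "w i = w (int t - r)"
    using periodic_cong[OF assms(2) r(3)] periodic_cong[OF assms(2) r(4)]
      periodic_cong[OF assms(4) r(3)] periodic_cong[OF assms(4) r(4)]
      assms(3)[of "r - int t"] assms(5)[of "r - int t"] by simp_all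
  show "z i = w i"
  proof (cases "r \<le> int (t div 2)")
    case True
    then show ?thesis using zr eq[of "nat r"] r by simp
  next
    case False
    then have "nat (int t - r) \<le> t div 2" by linarith
    then show ?thesis using zr eq[of "nat (int t - r)"] r by simp
  qed
qed

lemma bij_betw_u_of_z:
  assumes "t \<ge> 1"
  shows "bij_betw (u_of_z t) (symmetric_z_points s t)
    {u \<in> {..t div 2} \<rightarrow>\<^sub>E UNIV. (\<Sum>i\<le>t div 2. u i) = int (s div 2)}"
proof (rule bij_betw_imageI)
  show "inj_on (u_of_z t) (symmetric_z_points s t)"
  proof (rule inj_onI)
    fix z w assume zw: "z \<in> symmetric_z_points s t" "w \<in> symmetric_z_points s t"
      and eq: "u_of_z t z = u_of_z t w"
    note z = zw(1)[unfolded symmetric_z_points_iff[OF assms]]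
    note w = zw(2)[unfolded symmetric_z_points_iff[OF assms]]
    show "z = w"
    proof (rule symmetric_periodic_eqI[OF assms])
      fix n assume n: "n \<le> t div 2"
      have un: "u_of_z t z n = u_of_z t w n" using eq by simp
      show "z (int n) = w (int n)"
      proof (cases "n = 0")
        case True
        \<comment> \<open>\<open>u\<close> at 0 records only the floor of \<open>z 0 / 2\<close>;
          the value \<open>z 0\<close> itself is \<open>s\<close> minus twice the sum of the other
          entries.\<close>
        then show ?thesis using z w eq by simp
      next
        case False
        then show ?thesis using un n z w by (auto simp: u_of_z_def split: if_splits)
      qed
    qed (use z w in blast)+
  qed
  have "u_of_z t z \<in> {u \<in> {..t div 2} \<rightarrow>\<^sub>E UNIV. (\<Sum>i\<le>t div 2. u i) = int (s div 2)}"
    if "z \<in> symmetric_z_points s t" for z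
    using symmetric_z_points_zero(2)[OF assms that] by (auto simp: u_of_z_def)
  moreover have "u \<in> u_of_z t ` symmetric_z_points s t"
    if "u \<in> {..t div 2} \<rightarrow>\<^sub>E UNIV" "(\<Sum>i\<le>t div 2. u i) = int (s div 2)" for u
  proof -
    \<comment> \<open>The summand \<open>s mod 2\<close> restores the parity of \<open>z 0\<close>
      that the floor discards.\<close>
    define w where "w n =
      (if n = 0 then 2 * u 0 + int (s mod 2) else if even t \<and> n = t div 2 then 2 * u n else u n)" for n
    \<comment> \<open>The minimum is the distance from \<open>i\<close> to the nearest multiple of
      \<open>t\<close>, so \<open>z\<close> is periodic and symmetric by construction.\<close>
    define z where "z i = w (nat (min (i mod int t) (- i mod int t)))" for i
    have zw: "z (int n) = w n" if "n \<le> t div 2" for n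
    proof (cases "n = 0")
      case False
      have n: "int n < int t" using that False assms by linarith
      then have "int n mod int t = int n" by simp
      moreover have "- int n mod int t = int t - int n"
        using n False by (simp add: zmod_zminus1_eq_if)
      ultimately have "min (int n mod int t) (- int n mod int t) = int n" using that by linarith
      then show ?thesis by (simp add: z_def)
    qed (simp add: z_def)
    have uz: "u_of_z t z = u"
    proof
      fix n
      show "u_of_z t z n = u n"
      proof (cases "n \<le> t div 2")
        case True
        then show ?thesis using zw[OF True] by (auto simp: u_of_z_def w_def)
      next
        case False
        then show ?thesis using PiE_arb[OF that(1), of n] by (simp add: u_of_z_def)
      qed
    qed
    have "- (i + int t) mod int t = - i mod int t" for i
      using minus_mod_self2[of "- i" "int t"] by simp
    then have "periodic t z" by (simp add: periodic_def z_def)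
    moreover have "z i = z (- i)" for i by (simp add: z_def min.commute)
    moreover have "even (z (int (t div 2)))" if "even t"
      using that assms zw[of "t div 2"] by (auto simp: w_def)
    moreover have "z 0 = int s - 2 * (\<Sum>n\<in>{1..t div 2}. u_of_z t z n)"
    proof -
      have "{..t div 2} = insert 0 {1..t div 2}" by auto
      then have "u 0 + (\<Sum>n\<in>{1..t div 2}. u n) = int (s div 2)" using that(2) by simp
      moreover have "int s = 2 * int (s div 2) + int (s mod 2)" by (simp add: zdiv_int zmod_int)
      ultimately show ?thesis using zw[of 0] uz by (simp add: w_def)
    qed
    ultimately have "z \<in> symmetric_z_points s t" using symmetric_z_points_iff[OF assms] by blast
    then show ?thesis using uz by blast
  qed
  ultimately show "u_of_z t ` symmetric_z_points s t =
    {u \<in> {..t div 2} \<rightarrow>\<^sub>E UNIV. (\<Sum>i\<le>t div 2. u i) = int (s div 2)}" by blast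
qed

lemma u_of_z_nonneg_iff:
  assumes "t \<ge> 1" "z \<in> symmetric_z_points s t"
  shows "(\<forall>n\<le>t div 2. u_of_z t z n \<ge> 0) \<longleftrightarrow> (\<forall>i. z i \<ge> 0)"
proof
  assume "\<forall>i. z i \<ge> 0"
  then show "\<forall>n\<le>t div 2. u_of_z t z n \<ge> 0" by (auto simp: u_of_z_def)
next
  assume u: "\<forall>n\<le>t div 2. u_of_z t z n \<ge> 0"
  note z = assms(2)[unfolded symmetric_z_points_iff[OF assms(1)]]
  have half: "z (int n) \<ge> 0" if "n \<le> t div 2" for n
    using u[rule_format, OF that] that by (auto simp: u_of_z_def split: if_splits)
  \<comment> \<open>The absolute value of \<open>z\<close> is again symmetric and periodic, so
    agreement with \<open>z\<close> on the first half gives nonnegativity everywhere.\<close>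
  have "(\<lambda>i. \<bar>z i\<bar>) = z"
  proof (rule symmetric_periodic_eqI[OF assms(1)])
    show "\<bar>z i\<bar> = \<bar>z (- i)\<bar>" for i using z by metis
  qed (use z half in \<open>auto simp: periodic_def\<close>)
  then show "\<forall>i. z i \<ge> 0" by (metis abs_ge_zero)
qed

section \<open>From a- to z-coordinates\<close>

text \<open>The subtracted \<open>s\<close> compensates for the two indices being \<open>s\<close>
  apart.\<close>

lemma z_numerator_dvd:
  assumes "\<And>i. [a i = i] (mod int t)"
  shows "int t dvd z_numerator s t a j"
proof -
  let ?i = "int s * j + z_shift s t"
  have "[a ?i - (a (?i + int s) - int s) = ?i - (?i + int s - int s)] (mod int t)"
    by (intro cong_diff assms cong_refl)
  then show ?thesis
    by (simp add: z_numerator_def cong_0_iff algebra_simps)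
qed

lemma mult_z_of_a:
  assumes "\<And>i. [a i = i] (mod int t)"
  shows "int t * z_of_a s t a j = z_numerator s t a j"
  using z_numerator_dvd[OF assms] by (simp add: z_of_a_def)

lemma ex_index:
  assumes "coprime s t"
  shows "\<exists>j. [i = int s * j + z_shift s t] (mod int t)"
proof -
  have "coprime (int s) (int t)" using assms by simp
  then obtain r where r: "[int s * r = 1] (mod int t)"
    using cong_solve_coprime_int by blast
  \<comment> \<open>The index is \<open>r * (i - z_shift s t)\<close>, with \<open>r\<close> inverse
    to \<open>s\<close> modulo \<open>t\<close>.\<close>
  have "[int s * r * (i - z_shift s t) + z_shift s t = 1 * (i - z_shift s t) + z_shift s t] (mod int t)"
    by (intro cong_add cong_mult r cong_refl)
  then show ?thesis by (metis cong_sym diff_add_cancel mult.assoc mult_1)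
qed

text \<open>\<open>z_shift\<close> is chosen for this: it turns the reflection
  \<open>i \<mapsto> - 1 - i\<close> of residues into \<open>j \<mapsto> 1 - j\<close>, the two
  sides differing by \<open>(s + 1) * t\<close>.\<close>

lemma reflect_index:
  assumes "coprime s t"
  shows "[- 1 - (int s * j + z_shift s t) = int s * (1 - j) + z_shift s t] (mod int t)"
proof -
  have "int s * (1 - j) + z_shift s t = (- 1 - (int s * j + z_shift s t)) + int t * (int s + 1)"
    using two_times_z_shift[OF assms] by (simp add: algebra_simps)
  then show ?thesis unfolding cong_iff_lin by blast
qed

lemma a_reflect:
  assumes "coprime s t" "periodic t a" "\<And>i. a i + a (- 1 - i) = int t - 1"
  shows "a (int s * j + z_shift s t) + a (int s * (1 - j) + z_shift s t) = int t - 1"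
proof -
  show ?thesis using assms(3) periodic_cong[OF assms(2) reflect_index[OF assms(1)]] by metis
qed

lemma z_of_a_mem:
  assumes "t \<ge> 1" "coprime s t" "a \<in> symmetric_a_points t"
  shows "z_of_a s t a \<in> symmetric_z_points s t"
proof -
  have per: "periodic t a" and ai: "\<And>i. [a i = i] (mod int t)"
    and add: "\<And>i. a i + a (- 1 - i) = int t - 1"
    using assms(3) by (auto simp: symmetric_a_points_def)
  define A where "A j = a (int s * j + z_shift s t)" for j
  define z where "z = z_of_a s t a"
  have tz: "int t * z j = A j - A (j + 1) + int s" for j
    using mult_z_of_a[OF ai] by (simp add: z_def z_numerator_def A_def)
  \<comment> \<open>Identities for \<open>z\<close> are proved after multiplication by
    \<open>t\<close>, where they become identities for differences of \<open>A\<close>.\<close>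
  have cancel: "x = y" if "int t * x = int t * y" for x y using that assms(1) by simp
  have A_per: "A (j + int t) = A j" for j
    unfolding A_def by (rule periodic_cong[OF per]) (simp add: cong_iff_dvd_diff algebra_simps)
  have refl: "A j + A (1 - j) = int t - 1" for j
    using a_reflect[OF assms(2) per add] by (simp add: A_def)
  have zper: "periodic t z"
    unfolding periodic_def
  proof
    fix i
    have "int t * z (i + int t) = int t * z i"
      using A_per[of i] A_per[of "i + 1"] unfolding tz by (simp add: algebra_simps)
    then show "z (i + int t) = z i" by (rule cancel)
  qed
  have zsym: "z i = z (- i)" for i
  proof (rule cancel)
    show "int t * z i = int t * z (- i)"
      using refl[of i] refl[of "i + 1"] unfolding tz by (simp add: algebra_simps)
  qed
  have sum: "(\<Sum>i\<in>{0..<int t}. z i) = int s"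
  proof (rule cancel)
    have tele: "(\<Sum>n<m. A (int n) - A (int n + 1)) = A 0 - A (int m)" for m
      by (induction m) (auto simp: algebra_simps)
    have "int t * (\<Sum>i\<in>{0..<int t}. z i) = (\<Sum>n<t. (A (int n) - A (int n + 1)) + int s)"
      using sum.atLeast_int_lessThan_int_shift[of z 0 t]
      by (simp add: atLeast0LessThan sum_distrib_left tz)
    also have "\<dots> = A 0 - A (int t) + int t * int s" by (simp only: sum.distrib tele) simp
    also have "\<dots> = int t * int s" using A_per[of 0] by simp
    finally show "int t * (\<Sum>i\<in>{0..<int t}. z i) = int t * int s" .
  qed
  have ev: "even (z (int (t div 2)))" if "even t"
  proof -
    from that obtain m where m: "t = 2 * m" ..
    \<comment> \<open>Reflection sends \<open>m + 1\<close> to \<open>- m\<close>, which is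
      \<open>m\<close> modulo \<open>t = 2 * m\<close>.\<close>
    have "A (int m + 1) = int t - 1 - A (int m)"
      using refl[of "- int m"] A_per[of "- int m"] m by (simp add: algebra_simps)
    then have *: "int t * z (int m) = 2 * A (int m) - int t + 1 + int s" using tz[of "int m"] by simp
    obtain d where "A (int m) = int s * int m + z_shift s t + int t * d"
      using ai unfolding A_def by (metis cong_iff_lin cong_sym)
    \<comment> \<open>Twice \<open>A m\<close> is
      \<open>s * t + (s + 1) * (t - 1) + 2 * t * d\<close>; adding \<open>1 + s - t\<close> leaves
      \<open>2 * s * t + 2 * t * d\<close>.\<close>
    then have "int t * z (int m) = int t * (2 * (int s + d))"
      using * two_times_z_shift[OF assms(2)] m by (simp add: algebra_simps)
    then have "z (int m) = 2 * (int s + d)" by (rule cancel)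
    then show ?thesis using m by simp
  qed
  have "z \<in> symmetric_z_points s t"
    unfolding symmetric_z_points_def mem_Collect_eq weighted_sum_cong_iff[OF assms(1) zper zsym]
    using zper sum ev zsym by blast
  then show ?thesis by (simp add: z_def)
qed

text \<open>Equal \<open>z\<close> makes the difference of the two points constant in
  \<open>j\<close>; the reflection relation forces twice that constant to be 0.\<close>

lemma z_of_a_inj:
  assumes "t \<ge> 1" "coprime s t"
  shows "inj_on (z_of_a s t) (symmetric_a_points t)"
proof (rule inj_onI)
  fix a b assume "a \<in> symmetric_a_points t" "b \<in> symmetric_a_points t"
    and eq: "z_of_a s t a = z_of_a s t b"
  then have a: "periodic t a" "\<And>i. [a i = i] (mod int t)" "\<And>i. a i + a (- 1 - i) = int t - 1"
    and b: "periodic t b" "\<And>i. [b i = i] (mod int t)" "\<And>i. b i + b (- 1 - i) = int t - 1"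
    by (auto simp: symmetric_a_points_def)
  define D where "D j = a (int s * j + z_shift s t) - b (int s * j + z_shift s t)" for j
  have step: "D (j + 1) = D j" for j
    using mult_z_of_a[OF a(2), of s j] mult_z_of_a[OF b(2), of s j] eq
    by (simp add: D_def z_numerator_def)
  have const: "D j = D 0" for j
  proof (induction j rule: int_induct[where k = 0])
    case (step2 i) then show ?case using step[of "i - 1"] by simp
  qed (use step in auto)
  have "D 0 + D (1 - 0) = 0"
    using a_reflect[OF assms(2) a(1,3), of 0] a_reflect[OF assms(2) b(1,3), of 0]
    by (simp add: D_def)
  then have D: "D j = 0" for j using const[of 1] const[of j] by simp
  show "a = b"
  proof
    fix i
    obtain j where j: "[i = int s * j + z_shift s t] (mod int t)" using ex_index[OF assms(2)] by blast
    then show "a i = b i"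
      using periodic_cong[OF a(1) j] periodic_cong[OF b(1) j] D[of j] by (simp add: D_def)
  qed
qed

text \<open>The recursion for \<open>A\<close> is summed from a starting value fixed by reflection,
  and the index change \<open>j \<mapsto> s * j + k\<close> is then inverted modulo
  \<open>t\<close>.\<close>

lemma z_of_a_surj:
  assumes "t \<ge> 1" "coprime s t" "z \<in> symmetric_z_points s t"
  shows "z \<in> z_of_a s t ` symmetric_a_points t"
proof -
  have per: "periodic t z" and sym: "\<And>i. z i = z (- i)"
    and sum: "(\<Sum>i\<in>{0..<int t}. z i) = int s"
    using assms(3) by (auto simp: symmetric_z_points_def)
  define k where "k = z_shift s t"
  \<comment> \<open>\<open>z 0\<close> and \<open>s\<close> have equal parity, so the starting value
    of \<open>A\<close> below is an integer congruent to \<open>k\<close> modulo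
    \<open>t\<close>.\<close>
  obtain h where h: "z 0 = int s + 2 * h"
    using assms(3) unfolding symmetric_z_points_iff[OF assms(1)]
    by (metis diff_conv_add_uminus mult_minus_right)
  have k2: "2 * k = (int s + 1) * (int t - 1)"
    using two_times_z_shift[OF assms(2)] by (simp add: k_def)
  define F where "F m = (\<Sum>i\<in>{0..<m}. z i)" for m :: int
  have F_step: "F (m + 1) = F m + z m" if "m \<ge> 0" for m
  proof -
    have "{0..<m + 1} = insert m {0..<m}" using that by auto
    then show ?thesis by (simp add: F_def)
  qed
  txt \<open>
    \<open>A\<close> must satisfy \<open>A (j + 1) = A j + s - t * z j\<close>, and its value at 0 is forced by
    \<open>A 0 + A 1 = t - 1\<close>: it is \<open>(t - 1 - s + t * z 0) / 2 = k + t * h\<close>.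
  \<close>
  define A where "A j = k + int t * h + int s * (j mod int t) - int t * F (j mod int t)" for j
  have A_cong: "A i = A j" if "[i = j] (mod int t)" for i j
    using that by (simp add: A_def cong_def)
  have A_step: "A (j + 1) = A j + int s - int t * z j" for j
  proof -
    define m where "m = j mod int t"
    have m: "0 \<le> m" "m < int t" using assms(1) by (simp_all add: m_def)
    have zj: "z j = z m" by (rule periodic_cong[OF per]) (simp add: m_def cong_def)
    have j1: "(j + 1) mod int t = (m + 1) mod int t" by (simp add: m_def mod_add_left_eq)
    show ?thesis
    proof (cases "m + 1 = int t")
      case True
      \<comment> \<open>At the wrap-around, \<open>t\<close> increments of \<open>s\<close> are
        balanced by \<open>t\<close> times the sum of \<open>z\<close>, so \<open>A\<close> returns
        to its start.\<close>
      have "F (int t) = int s" using sum by (simp add: F_def)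
      moreover have "int t * F (int t) = int t * F m + int t * z m"
        using F_step[OF m(1)] True by (simp add: distrib_left)
      moreover have "F 0 = 0" by (simp add: F_def)
      moreover have "(j + 1) mod int t = 0" using j1 True by simp
      moreover have "int s * m = int s * int t - int s" using True by (simp add: algebra_simps flip: True)
      ultimately show ?thesis
        unfolding A_def zj m_def[symmetric] by (simp add: algebra_simps)
    next
      case False
      then have "(j + 1) mod int t = m + 1" using j1 m by simp
      then show ?thesis
        unfolding A_def zj m_def[symmetric] by (simp only: F_step[OF m(1)] distrib_left)
    qed
  qed
  have refl: "A j + A (1 - j) = int t - 1" for j
  proof -
    define G where "G j = A j + A (1 - j)" for j
    \<comment> \<open>Because \<open>z j = z (- j)\<close>, the increase of \<open>A\<close> from
      \<open>j\<close> to \<open>j + 1\<close> equals its increase from \<open>- j\<close> to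
      \<open>1 - j\<close>.\<close>
    have step: "G (j + 1) = G j" for j
      using A_step[of j] A_step[of "- j"] sym[of j] by (simp add: G_def)
    have "G j = G 0"
    proof (induction j rule: int_induct[where k = 0])
      case (step2 i) then show ?case using step[of "i - 1"] by simp
    qed (use step in auto)
    moreover have "A 0 = k + int t * h" by (simp add: A_def F_def)
    then have "G 0 = int t - 1"
      using A_step[of 0] h k2 by (simp add: G_def algebra_simps)
    ultimately show ?thesis by (simp add: G_def)
  qed
  have Ak: "[A j = int s * j + k] (mod int t)" for j
  proof -
    have "int s * j + k - A j = int t * (int s * (j div int t) - h + F (j mod int t))"
    proof -
      have "int s * j = int s * (j mod int t) + int t * (int s * (j div int t))"
        by (metis distrib_left mod_mult_div_eq mult.left_commute)
      then show ?thesis by (simp add: A_def algebra_simps)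
    qed
    then show ?thesis by (metis cong_iff_dvd_diff cong_sym dvd_triv_left)
  qed
  have "coprime (int s) (int t)" using assms(2) by simp
  then obtain r where r: "[int s * r = 1] (mod int t)"
    using cong_solve_coprime_int by blast
  define a where "a i = A (r * (i - k))" for i
  have aA: "a (int s * j + k) = A j" for j
  proof -
    have "[int s * r * j = 1 * j] (mod int t)" by (intro cong_mult r cong_refl)
    then show ?thesis unfolding a_def by (intro A_cong) (simp add: algebra_simps)
  qed
  have a_per: "periodic t a"
    unfolding periodic_def a_def by (intro allI A_cong) (simp add: cong_iff_dvd_diff algebra_simps)
  have a_cong: "[a i = i] (mod int t)" for i
  proof -
    obtain j where j: "[i = int s * j + k] (mod int t)"
      using ex_index[OF assms(2)] unfolding k_def by blast
    then have "a i = A j" using periodic_cong[OF a_per j] aA by simp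
    then show ?thesis using Ak j by (metis cong_sym cong_trans)
  qed
  have a_add: "a i + a (- 1 - i) = int t - 1" for i
  proof -
    obtain j where j: "[i = int s * j + k] (mod int t)"
      using ex_index[OF assms(2)] unfolding k_def by blast
    have "[- 1 - i = - 1 - (int s * j + k)] (mod int t)" using j by (intro cong_diff cong_refl)
    moreover have "[- 1 - (int s * j + k) = int s * (1 - j) + k] (mod int t)"
      using reflect_index[OF assms(2)] by (simp add: k_def)
    ultimately have "a (- 1 - i) = A (1 - j)"
      using periodic_cong[OF a_per] aA by metis
    moreover have "a i = A j" using periodic_cong[OF a_per j] aA by simp
    ultimately show ?thesis using refl by simp
  qed
  have "a \<in> symmetric_a_points t"
    unfolding symmetric_a_points_def
    using a_per a_cong a_add symmetric_sum_eq[OF a_per a_add assms(1)] by blast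
  moreover have "z_of_a s t a = z"
  proof
    fix j
    have "int t * z_of_a s t a j = int t * z j"
      unfolding mult_z_of_a[OF a_cong] z_numerator_def k_def[symmetric] aA A_step by simp
    then show "z_of_a s t a j = z j" using assms(1) by simp
  qed
  ultimately show ?thesis by blast
qed

lemma bij_betw_z_of_a:
  assumes "t \<ge> 1" "coprime s t"
  shows "bij_betw (z_of_a s t) (symmetric_a_points t) (symmetric_z_points s t)"
  using z_of_a_inj[OF assms] z_of_a_mem[OF assms] z_of_a_surj[OF assms]
  by (intro bij_betw_imageI) auto

text \<open>\<open>t * z j\<close> is the slack in the inequality at \<open>i = s * j + k\<close>,
  where \<open>k\<close> is \<open>z_shift s t\<close>, and these \<open>i\<close> represent all
  residues.\<close>

lemma z_of_a_nonneg_iff: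
  assumes "t \<ge> 1" "coprime s t" "a \<in> symmetric_a_points t"
  shows "(\<forall>j. z_of_a s t a j \<ge> 0) \<longleftrightarrow> (\<forall>i. a i \<ge> a (i + int s) - int s)"
proof -
  have per: "periodic t a" and ai: "\<And>i. [a i = i] (mod int t)"
    using assms(3) by (auto simp: symmetric_a_points_def)
  have *: "z_of_a s t a j \<ge> 0 \<longleftrightarrow> z_numerator s t a j \<ge> 0" for j
    unfolding mult_z_of_a[OF ai, symmetric] using assms(1) by (simp add: zero_le_mult_iff)
  show ?thesis
  proof
    assume nonneg: "\<forall>j. z_of_a s t a j \<ge> 0"
    show "\<forall>i. a i \<ge> a (i + int s) - int s"
    proof
      fix i
      obtain j where j: "[i = int s * j + z_shift s t] (mod int t)"
        using ex_index[OF assms(2)] by blast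
      then have "[i + int s = int s * j + z_shift s t + int s] (mod int t)"
        by (intro cong_add cong_refl)
      then have "a (i + int s) = a (int s * (j + 1) + z_shift s t)"
        using periodic_cong[OF per] by (simp add: algebra_simps)
      moreover have "z_numerator s t a j \<ge> 0" using nonneg * by blast
      ultimately show "a i \<ge> a (i + int s) - int s"
        using periodic_cong[OF per j] by (simp add: z_numerator_def)
    qed
  next
    assume le: "\<forall>i. a i \<ge> a (i + int s) - int s"
    have eq: "int s * j + z_shift s t + int s = int s * (j + 1) + z_shift s t" for j
      by (simp add: algebra_simps)
    have "z_numerator s t a j \<ge> 0" for j
      using le[rule_format, of "int s * j + z_shift s t"] unfolding eq z_numerator_def by simp
    then show "\<forall>j. z_of_a s t a j \<ge> 0" using * by blast
  qed
qed

section \<open>Simultaneous cores\<close>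

text \<open>Carries the bijections for self-conjugate \<open>t\<close>-cores over to those that are
  also \<open>s\<close>-cores.\<close>

lemma bij_betw_restrict:
  assumes "bij_betw f A B" "\<And>x. x \<in> A \<Longrightarrow> Q (f x) \<longleftrightarrow> P x"
  shows "bij_betw f {x \<in> A. P x} {y \<in> B. Q y}"
proof (rule bij_betw_subset[OF assms(1)])
  show "f ` {x \<in> A. P x} = {y \<in> B. Q y}"
    using assms by (auto simp: bij_betw_def)
qed auto

theorem proposition6p11:
  fixes s t :: nat
  assumes "s \<ge> 1" and "t \<ge> 1" and "coprime s t"
  defines "s' \<equiv> s div 2" and "t' \<equiv> t div 2"
  defines "u_simplex \<equiv>
      {u \<in> {..t'} \<rightarrow>\<^sub>E (UNIV :: int set). (\<forall>i\<le>t'. u i \<ge> 0) \<and> (\<Sum>i\<le>t'. u i) = int s'}"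
    and "a_symmetric \<equiv>
      {a :: int \<Rightarrow> int. periodic t a \<and>
         (\<Sum>i\<in>{0..<int t}. a i) = int (t choose 2) \<and>
         (\<forall>i. [a i = i] (mod int t)) \<and>
         (\<forall>i. a i + a (- 1 - i) = int t - 1)}"
    and "z_symmetric \<equiv>
      {z :: int \<Rightarrow> int. periodic t z \<and>
         (\<Sum>i\<in>{0..<int t}. z i) = int s \<and>
         [(\<Sum>i\<in>{0..<int t}. i * z i) = 0] (mod int t) \<and>
         (\<forall>i. z i = z (- i))}"
    and "u_hyperplane \<equiv>
      {u \<in> {..t'} \<rightarrow>\<^sub>E (UNIV :: int set). (\<Sum>i\<le>t'. u i) = int s'}"
  shows
    "(bij_betw (a_coord t) (self_conjugate_cores s \<inter> self_conjugate_cores t) (B_points t s) \<and>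
      bij_betw (z_coord s t) (self_conjugate_cores s \<inter> self_conjugate_cores t) (U_points t s) \<and>
      bij_betw (u_coord s t) (self_conjugate_cores s \<inter> self_conjugate_cores t) u_simplex \<and>
      bij_betw (z_of_a s t) (B_points t s) (U_points t s) \<and>
      (\<forall>a\<in>B_points t s. \<forall>j. int t dvd z_numerator s t a j) \<and>
      bij_betw (u_of_z t) (U_points t s) u_simplex \<and>
      (\<forall>z\<in>U_points t s.
         z 0 div 2 = int s' - (\<Sum>i\<in>{1..t'}. u_of_z t z i) \<and>
         (even t \<longrightarrow> even (z (int t'))))) \<and>
     (bij_betw (a_coord t) (self_conjugate_cores t) a_symmetric \<and>
      bij_betw (z_coord s t) (self_conjugate_cores t) z_symmetric \<and>
      bij_betw (u_coord s t) (self_conjugate_cores t) u_hyperplane \<and>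
      (\<forall>a\<in>a_symmetric. \<forall>j. int t dvd z_numerator s t a j) \<and>
      (\<forall>z\<in>z_symmetric. even t \<longrightarrow> even (z (int t'))))"
proof -
  have a_eq: "a_symmetric = symmetric_a_points t"
    by (simp add: a_symmetric_def symmetric_a_points_def)
  have z_eq: "z_symmetric = symmetric_z_points s t"
    by (simp add: z_symmetric_def symmetric_z_points_def)
  \<comment> \<open>Each set of part (1) is the corresponding set of part (2) cut down by one
    condition: the inequalities on \<open>a\<close>, nonnegativity of \<open>z\<close> or of
    \<open>u\<close>, or being an \<open>s\<close>-core.\<close>
  have B_eq: "B_points t s = {a \<in> symmetric_a_points t. \<forall>i. a i \<ge> a (i + int s) - int s}"
    by (auto simp: B_points_def A_points_def symmetric_a_points_def)
  have U_eq: "U_points t s = {z \<in> symmetric_z_points s t. \<forall>i. z i \<ge> 0}"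
    unfolding U_points_def TD_points_def symmetric_z_points_def by blast
  have simplex_eq: "u_simplex = {u \<in> u_hyperplane. \<forall>i\<le>t'. u i \<ge> 0}"
    by (auto simp: u_simplex_def u_hyperplane_def)
  have cores_eq: "self_conjugate_cores s \<inter> self_conjugate_cores t =
      {l \<in> self_conjugate_cores t. l \<in> cores s}"
    by (auto simp: self_conjugate_cores_def)
  have a: "bij_betw (a_coord t) (self_conjugate_cores t) a_symmetric"
    unfolding a_eq by (rule bij_betw_a_coord[OF assms(2)])
  have z: "bij_betw (z_of_a s t) a_symmetric z_symmetric"
    unfolding a_eq z_eq by (rule bij_betw_z_of_a[OF assms(2,3)])
  have u: "bij_betw (u_of_z t) z_symmetric u_hyperplane"
    unfolding z_eq u_hyperplane_def s'_def t'_def by (rule bij_betw_u_of_z[OF assms(2)])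
  have a': "bij_betw (a_coord t) (self_conjugate_cores s \<inter> self_conjugate_cores t) (B_points t s)"
    unfolding cores_eq B_eq using cores_a_coord_iff[OF _ assms(2,1)]
    by (intro bij_betw_restrict a[unfolded a_eq]) (auto simp: self_conjugate_cores_def)
  have z': "bij_betw (z_of_a s t) (B_points t s) (U_points t s)"
    unfolding B_eq U_eq using z_of_a_nonneg_iff[OF assms(2,3)]
    by (intro bij_betw_restrict z[unfolded a_eq z_eq])
  have u': "bij_betw (u_of_z t) (U_points t s) u_simplex"
    unfolding U_eq simplex_eq t'_def using u_of_z_nonneg_iff[OF assms(2)]
    by (intro bij_betw_restrict u[unfolded z_eq])
  have z_coord: "z_coord s t = z_of_a s t \<circ> a_coord t"
    by (simp add: fun_eq_iff z_coord_def)
  have u_coord: "u_coord s t = u_of_z t \<circ> z_coord s t"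
    by (simp add: fun_eq_iff u_coord_def)
  have zc: "bij_betw (z_coord s t) (self_conjugate_cores t) z_symmetric"
    unfolding z_coord by (rule bij_betw_trans[OF a z])
  have zc': "bij_betw (z_coord s t) (self_conjugate_cores s \<inter> self_conjugate_cores t) (U_points t s)"
    unfolding z_coord by (rule bij_betw_trans[OF a' z'])
  have uc: "bij_betw (u_coord s t) (self_conjugate_cores t) u_hyperplane"
    unfolding u_coord by (rule bij_betw_trans[OF zc u])
  have uc': "bij_betw (u_coord s t) (self_conjugate_cores s \<inter> self_conjugate_cores t) u_simplex"
    unfolding u_coord by (rule bij_betw_trans[OF zc' u'])
  have dvd: "\<forall>a\<in>a_symmetric. \<forall>j. int t dvd z_numerator s t a j"
    using z_numerator_dvd by (simp add: a_symmetric_def)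
  have ev: "\<forall>z\<in>z_symmetric. even t \<longrightarrow> even (z (int t'))"
    unfolding z_eq t'_def using symmetric_z_points_iff[OF assms(2)] by blast
  have sub: "B_points t s \<subseteq> a_symmetric" "U_points t s \<subseteq> z_symmetric"
    unfolding a_eq z_eq B_eq U_eq by blast+
  have zero: "\<forall>z\<in>z_symmetric. z 0 div 2 = int s' - (\<Sum>i\<in>{1..t'}. u_of_z t z i)"
    unfolding z_eq s'_def t'_def using symmetric_z_points_zero(1)[OF assms(2)] by blast
  show ?thesis
    using a z u a' z' u' zc zc' uc uc' dvd ev sub zero by (intro conjI) (blast+)?
qed

end
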